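(* Let $G$ be a commutative preordered group and $S$ an equivariant system of ideals for $G$. Let $L(S)$ be the union of the systems $U_{x_1}\cdots U_{x_n}(S)$ over all finite sequences $x_1,\dots,x_n$ of elements of $G$. Then $L(S)$ is the least regular equivariant system of ideals containing $S$.
   Context: $G$ is an abelian group with a preorder $\leqslant$ such that $a\leqslant b$ implies $a+c\leqslant b+c$. For nonempty finite subsets $A,B$ of $G$ write $A,B$ for $A\cup B$, $a$ for $\{a\}$, $A+x=\{a+x:a\in A\}$, $A-x=\{a-x:a\in A\}$, $A+B=\{a+b:a\in A,b\in B\}$. An equivariant system of ideals is a predicate $S$ on nonempty finite subsets of $G$ such that: (P1) $S(A)$ if $A\supseteq A'$ and $S(A')$; (P2') $S(A)$ if $S(A,u)$ and $S(A-u)$; (P3) $S(a)$ if $a\leqslant 0$ in $G$. It is regular if moreover (P2) $S(A+B)$ whenever $S(A+B,A)$ and $S(A+B,B)$, and (P5) $S(x,-x)$ for all $x\in G$. We say $S\subseteq S'$ (``$S'$ contains $S$'') if $S(A)$ implies $S'(A)$. Equivariant systems of ideals are closed under intersections. For $x\in G$, $T_x(S)$ is the least equivariant system of ideals $Q$ containing $S$ with $Q(x)$, and $U_x(S)=T_x(S)\cap T_{-x}(S)$. The systems $U_{x_1}\cdots U_{x_n}(S)$ form a directed family. *)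

theory Defs
  imports Main "HOL-Library.Set_Algebras"
begin

text \<open>The library's \<^class>\<open>ordered_ab_group_add\<close> is based on partial orders; here antisymmetry
  is not required.\<close>

class preordered_ab_group_add = ab_group_add + preorder +
  assumes preordered_add_right_mono: "a \<le> b \<Longrightarrow> a + c \<le> b + c"

text \<open>A predicate on nonempty finite subsets is encoded as a predicate on all sets that is false on
  the empty set and on infinite sets. Inclusion of systems is then the pointwise order
  \<open>S \<le> S'\<close>, and intersections and unions are the lattice operations on predicates.
  \<open>A + B\<close> is the elementwise sum of sets.\<close>

definition equivariant_system :: "('a::preordered_ab_group_add set \<Rightarrow> bool) \<Rightarrow> bool" where
  "equivariant_system S \<longleftrightarrow>
     (\<forall>A. S A \<longrightarrow> finite A \<and> A \<noteq> {}) \<and>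
     (\<forall>A A'. finite A \<and> A' \<subseteq> A \<and> S A' \<longrightarrow> S A) \<and>
     (\<forall>A u. finite A \<and> A \<noteq> {} \<and> S (A \<union> {u}) \<and> S ((\<lambda>a. a - u) ` A) \<longrightarrow> S A) \<and>
     (\<forall>a. a \<le> 0 \<longrightarrow> S {a})"

definition regular_system :: "('a::preordered_ab_group_add set \<Rightarrow> bool) \<Rightarrow> bool" where
  "regular_system S \<longleftrightarrow>
     equivariant_system S \<and>
     (\<forall>A B. finite A \<and> A \<noteq> {} \<and> finite B \<and> B \<noteq> {} \<and>
        S ((A + B) \<union> A) \<and> S ((A + B) \<union> B) \<longrightarrow> S (A + B)) \<and>
     (\<forall>x. S {x, - x})"

definition T_system :: "'a::preordered_ab_group_add \<Rightarrow> ('a set \<Rightarrow> bool) \<Rightarrow> ('a set \<Rightarrow> bool)" where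
  "T_system x S = (LEAST Q. equivariant_system Q \<and> S \<le> Q \<and> Q {x})"

definition U_system :: "'a::preordered_ab_group_add \<Rightarrow> ('a set \<Rightarrow> bool) \<Rightarrow> ('a set \<Rightarrow> bool)" where
  "U_system x S = inf (T_system x S) (T_system (- x) S)"

text \<open>\<open>foldr U_system [x\<^sub>1, \<dots>, x\<^sub>n] S\<close> is \<open>U_system x\<^sub>1 (\<dots> (U_system x\<^sub>n S))\<close>.\<close>

definition L_system :: "('a::preordered_ab_group_add set \<Rightarrow> bool) \<Rightarrow> ('a set \<Rightarrow> bool)" where
  "L_system S = (SUP xs::'a list. foldr U_system xs S)"

text \<open>The least system in the definition of \<^const>\<open>T_system\<close> exists.\<close>

lemma equivariant_system_Inf:
  assumes "F \<noteq> {}" and F: "\<And>Q. Q \<in> F \<Longrightarrow> equivariant_system Q"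
  shows "equivariant_system (Inf F)"
proof -
  have InfI: "Inf F A" if "\<And>Q. Q \<in> F \<Longrightarrow> Q A" for A
    using that by (auto simp: Inf_apply)
  have InfD: "Q A" if "Inf F A" "Q \<in> F" for Q A
    using Inf_lower[OF that(2)] that(1) by (rule predicate1D)
  obtain Q0 where Q0: "Q0 \<in> F" using assms(1) by auto
  show ?thesis
    unfolding equivariant_system_def
  proof (intro conjI allI impI)
    fix A assume "Inf F A"
    then have "Q0 A" using Q0 by (rule InfD)
    moreover have "\<forall>A. Q0 A \<longrightarrow> finite A \<and> A \<noteq> {}"
      using F[OF Q0] unfolding equivariant_system_def by (elim conjE)
    ultimately show "finite A" "A \<noteq> {}" by simp_all
  next
    fix A A' assume "finite A \<and> A' \<subseteq> A \<and> Inf F A'"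
    then have fin: "finite A" "A' \<subseteq> A" "Inf F A'" by blast+
    show "Inf F A"
    proof (rule InfI)
      fix Q assume Q: "Q \<in> F"
      have *: "\<forall>A A'. finite A \<and> A' \<subseteq> A \<and> Q A' \<longrightarrow> Q A"
        using F[OF Q] unfolding equivariant_system_def by (elim conjE)
      show "Q A"
        by (rule *[rule_format, of A A']) (intro conjI fin InfD[OF fin(3) Q])
    qed
  next
    fix A u assume "finite A \<and> A \<noteq> {} \<and> Inf F (A \<union> {u}) \<and> Inf F ((\<lambda>a. a - u) ` A)"
    then have fin: "finite A" "A \<noteq> {}" "Inf F (A \<union> {u})" "Inf F ((\<lambda>a. a - u) ` A)" by blast+
    show "Inf F A"
    proof (rule InfI)
      fix Q assume Q: "Q \<in> F"
      have *: "\<forall>A u. finite A \<and> A \<noteq> {} \<and> Q (A \<union> {u}) \<and> Q ((\<lambda>a. a - u) ` A) \<longrightarrow> Q A"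
        using F[OF Q] unfolding equivariant_system_def by (elim conjE)
      show "Q A"
        by (rule *[rule_format, of A u]) (intro conjI fin InfD[OF fin(3) Q] InfD[OF fin(4) Q])
    qed
  next
    fix a :: 'a assume "a \<le> 0"
    show "Inf F {a}"
    proof (rule InfI)
      fix Q assume Q: "Q \<in> F"
      have "\<forall>a. a \<le> 0 \<longrightarrow> Q {a}"
        using F[OF Q] unfolding equivariant_system_def by (elim conjE)
      then show "Q {a}" using \<open>a \<le> 0\<close> by simp
    qed
  qed
qed

lemma T_system_least:
  assumes S: "equivariant_system S"
  shows "equivariant_system (T_system x S)" and "S \<le> T_system x S" and "T_system x S {x}"
    and "\<And>Q. equivariant_system Q \<Longrightarrow> S \<le> Q \<Longrightarrow> Q {x} \<Longrightarrow> T_system x S \<le> Q"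
proof -
  define F where "F = {Q. equivariant_system Q \<and> S \<le> Q \<and> Q {x}}"
  have "equivariant_system (\<lambda>A::'a set. finite A \<and> A \<noteq> {})"
    unfolding equivariant_system_def by auto
  moreover have "S \<le> (\<lambda>A. finite A \<and> A \<noteq> {})"
  proof (rule predicate1I)
    fix A assume "S A"
    moreover have "\<forall>A. S A \<longrightarrow> finite A \<and> A \<noteq> {}"
      using S unfolding equivariant_system_def by (elim conjE)
    ultimately show "finite A \<and> A \<noteq> {}" by (elim allE impE)
  qed
  ultimately have "(\<lambda>A. finite A \<and> A \<noteq> {}) \<in> F"
    by (simp add: F_def)
  then have "equivariant_system (Inf F)"
    by (intro equivariant_system_Inf) (auto simp: F_def)
  moreover have "S \<le> Inf F" by (rule Inf_greatest) (simp add: F_def)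
  moreover have "Inf F {x}" by (simp add: F_def)
  moreover have least: "Inf F \<le> Q" if "equivariant_system Q" "S \<le> Q" "Q {x}" for Q
    by (rule Inf_lower) (simp add: F_def that)
  ultimately have "T_system x S = Inf F"
    unfolding T_system_def by (intro Least_equality) auto
  then show "equivariant_system (T_system x S)" "S \<le> T_system x S" "T_system x S {x}"
    "\<And>Q. equivariant_system Q \<Longrightarrow> S \<le> Q \<Longrightarrow> Q {x} \<Longrightarrow> T_system x S \<le> Q"
    using \<open>equivariant_system (Inf F)\<close> \<open>S \<le> Inf F\<close> \<open>Inf F {x}\<close> least by simp_all
qed

end

theory Submission
  imports Defs
begin

text \<open>Read \<open>S A\<close> as \<open>\<Sqinter>A \<le> 0\<close>. Forcing \<open>x \<le> 0\<close> lets one replace \<open>A\<close> by the union of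
  \<open>A, A - x, \<dots>, A - p x\<close>, which describes \<open>T\<^sub>x\<close> explicitly; hence \<open>T\<^sub>x\<close> preserves intersections and
  commutes with every \<open>U\<^sub>y\<close>. So \<open>U\<^sub>x\<^sub>1 \<cdots> U\<^sub>x\<^sub>n S\<close> holds of \<open>D\<close> as soon as every system above \<open>S\<close> that
  decides the sign of each \<open>x\<^sub>i\<close> holds of \<open>D\<close>. A system that decides the differences of elements of
  \<open>A\<close> and of \<open>B\<close> replaces these sets by their minima, which reduces the regularity condition to
  singletons. For leastness, the explicit description of \<open>T\<^sub>x\<close> gives \<open>U\<^sub>x R \<le> R\<close> for regular \<open>R\<close>.\<close>

section \<open>Equivariant systems\<close>

lemma equivariant_systemD:
  assumes "equivariant_system S" "S A"
  shows "finite A" "A \<noteq> {}"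
proof -
  have "\<forall>A. S A \<longrightarrow> finite A \<and> A \<noteq> {}"
    using assms(1) unfolding equivariant_system_def by (elim conjE)
  with assms(2) show "finite A" "A \<noteq> {}" by blast+
qed

lemma equivariant_system_mono:
  assumes "equivariant_system S" "S A'" "A' \<subseteq> A" "finite A"
  shows "S A"
proof -
  have "\<forall>A A'. finite A \<and> A' \<subseteq> A \<and> S A' \<longrightarrow> S A"
    using assms(1) unfolding equivariant_system_def by (elim conjE)
  with assms(2-) show ?thesis by blast
qed

lemma equivariant_system_cut:
  assumes "equivariant_system S" "S (A \<union> {u})" "S ((\<lambda>a. a - u) ` A)"
  shows "S A"
proof -
  have "\<forall>A u. finite A \<and> A \<noteq> {} \<and> S (A \<union> {u}) \<and> S ((\<lambda>a. a - u) ` A) \<longrightarrow> S A"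
    using assms(1) unfolding equivariant_system_def by (elim conjE)
  moreover have "finite A" "A \<noteq> {}"
    using equivariant_systemD[OF assms(1,2)] equivariant_systemD[OF assms(1,3)] by auto
  ultimately show ?thesis using assms(2,3) by blast
qed

lemma equivariant_system_singleton:
  assumes "equivariant_system S" "a \<le> 0"
  shows "S {a}"
  using assms unfolding equivariant_system_def by blast

lemma equivariant_systemI:
  assumes "\<And>A. S A \<Longrightarrow> finite A" "\<And>A. S A \<Longrightarrow> A \<noteq> {}"
    and "\<And>A A'. S A' \<Longrightarrow> A' \<subseteq> A \<Longrightarrow> finite A \<Longrightarrow> S A"
    and "\<And>A u. S (A \<union> {u}) \<Longrightarrow> S ((\<lambda>a. a - u) ` A) \<Longrightarrow> S A"
    and "\<And>a. a \<le> 0 \<Longrightarrow> S {a}"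
  shows "equivariant_system S"
  unfolding equivariant_system_def using assms by (intro conjI allI impI) blast+

text \<open>The elements of \<open>C\<close> are cut one at a time. The translate condition on
  \<open>A\<close> passes to the larger sets \<open>A \<union> C\<close> by monotonicity.\<close>

lemma equivariant_system_cuts:
  assumes S: "equivariant_system S" and "finite C" "S (A \<union> C)"
    and "\<And>c. c \<in> C \<Longrightarrow> S ((\<lambda>a. a - c) ` A)"
  shows "S A"
  using assms(2-)
proof (induction C)
  case (insert c C)
  have "finite (A \<union> C)" using equivariant_systemD(1)[OF S insert.prems(1)] by auto
  then have "S ((\<lambda>a. a - c) ` (A \<union> C))"
    by (intro equivariant_system_mono[OF S insert.prems(2)[of c]]) auto
  moreover have "S ((A \<union> C) \<union> {c})" using insert.prems(1) by simp
  ultimately have "S (A \<union> C)" by (metis equivariant_system_cut[OF S])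
  then show ?case using insert.IH insert.prems(2) by blast
qed simp

text \<open>\<open>S {a - b}\<close> acts as \<open>a \<le> b\<close>, so \<open>S\<close> induces a
  preorder on the group. Translating \<open>{a - c}\<close> by the cut element \<open>b - c\<close>
  gives \<open>{a - b}\<close>.\<close>

lemma equivariant_system_trans:
  assumes S: "equivariant_system S" and "S {a - b}" "S {b - c}"
  shows "S {a - c}"
proof (rule equivariant_system_cut[OF S, of _ "b - c"])
  show "S ({a - c} \<union> {b - c})"
    by (rule equivariant_system_mono[OF S assms(3)]) auto
  show "S ((\<lambda>a. a - (b - c)) ` {a - c})" using assms(2) by simp
qed

lemma equivariant_system_inf:
  assumes "equivariant_system S" "equivariant_system S'"
  shows "equivariant_system (inf S S')"
  using equivariant_system_Inf[of "{S, S'}"] assms by auto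

section \<open>The systems T and U\<close>

text \<open>The \<open>p\<close>-th iterate at \<open>A\<close> is the union of the translates
  \<open>A - k x\<close> for \<open>k\<close> from \<open>0\<close> to \<open>p\<close>. As an
  iterate, it is unwound by adding or removing one shift.\<close>

definition downshift :: "'a::ab_group_add \<Rightarrow> 'a set \<Rightarrow> 'a set" where
  "downshift x A = A \<union> (\<lambda>a. a - x) ` A"

lemma downshift_pow_Suc:
  "(downshift x ^^ Suc p) A = (downshift x ^^ p) A \<union> (\<lambda>a. a - x) ` (downshift x ^^ p) A"
  unfolding funpow.simps o_apply by (rule downshift_def)

lemma downshift_pow_Un: "(downshift x ^^ p) (A \<union> B) = (downshift x ^^ p) A \<union> (downshift x ^^ p) B"
  by (induction p) (auto simp: downshift_def)

lemma downshift_pow_mono: "A \<subseteq> B \<Longrightarrow> (downshift x ^^ p) A \<subseteq> (downshift x ^^ p) B"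
  by (metis downshift_pow_Un subset_Un_eq)

lemma downshift_pow_increasing:
  assumes "p \<le> q"
  shows "(downshift x ^^ p) A \<subseteq> (downshift x ^^ q) A"
  by (rule lift_Suc_mono_le[OF _ assms]) (auto simp: downshift_def)

lemma finite_downshift_pow: "finite ((downshift x ^^ p) A) \<longleftrightarrow> finite A"
proof
  show "finite A" if "finite ((downshift x ^^ p) A)"
    using finite_subset[OF downshift_pow_increasing[of 0 p x A] that] by simp
  show "finite ((downshift x ^^ p) A)" if "finite A"
    using that by (induction p) (auto simp: downshift_def)
qed

lemma downshift_pow_empty: "(downshift x ^^ p) {} = {}"
  by (induction p) (auto simp: downshift_def)

lemma downshift_pow_translate:
  "(downshift x ^^ p) ((\<lambda>a. a - u) ` A) = (\<lambda>a. a - u) ` (downshift x ^^ p) A"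
  by (induction p) (auto simp: downshift_def image_Un image_image algebra_simps)

text \<open>Here \<open>v = u - k x\<close> with \<open>k\<close> at most \<open>p\<close>, and
  \<open>b - u = (b - k x) - v\<close>, so at most \<open>p\<close> further shifts of
  \<open>b\<close> are needed.\<close>

lemma translate_subset_downshift_pow:
  assumes "v \<in> (downshift x ^^ p) {u}"
  shows "(\<lambda>a. a - u) ` (downshift x ^^ q) A \<subseteq> (\<lambda>a. a - v) ` (downshift x ^^ (p + q)) A"
  using assms
proof (induction p arbitrary: v)
  case (Suc p)
  then consider "v \<in> (downshift x ^^ p) {u}" | w where "w \<in> (downshift x ^^ p) {u}" "v = w - x"
    by (auto simp: downshift_pow_Suc simp del: funpow.simps)
  then show ?case
  proof cases
    case 1
    have "(\<lambda>a. a - v) ` (downshift x ^^ (p + q)) A \<subseteq> (\<lambda>a. a - v) ` (downshift x ^^ (Suc p + q)) A"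
      by (intro image_mono downshift_pow_increasing) simp
    then show ?thesis using Suc.IH[OF 1] by blast
  next
    case (2 w)
    have "(\<lambda>a. a - w) ` (downshift x ^^ (p + q)) A \<subseteq> (\<lambda>a. a - v) ` (downshift x ^^ (Suc p + q)) A"
    proof (rule image_subsetI)
      fix a assume "a \<in> (downshift x ^^ (p + q)) A"
      then have "a - x \<in> (downshift x ^^ (Suc p + q)) A"
        by (simp add: downshift_pow_Suc del: funpow.simps)
      moreover have "a - w = (a - x) - v" using 2(2) by simp
      ultimately show "a - w \<in> (\<lambda>a. a - v) ` (downshift x ^^ (Suc p + q)) A" by blast
    qed
    then show ?thesis using Suc.IH[OF 2(1)] by blast
  qed
qed simp

text \<open>A shifted element \<open>a - x\<close> can be cut away because translating by it sends
  \<open>a\<close> to \<open>x\<close>, and \<open>S {x}\<close> holds.\<close>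

lemma equivariant_downshift_pow:
  assumes S: "equivariant_system S" and "S {x}" "S ((downshift x ^^ p) A)"
  shows "S A"
  using assms(3)
proof (induction p)
  case (Suc p)
  let ?C = "(downshift x ^^ p) A"
  have SC: "S (?C \<union> (\<lambda>a. a - x) ` ?C)" using Suc.prems by (simp only: downshift_pow_Suc)
  have fin: "finite ?C" using equivariant_systemD(1)[OF S SC] by simp
  have "S ?C"
  proof (rule equivariant_system_cuts[OF S _ SC])
    fix c assume "c \<in> (\<lambda>a. a - x) ` ?C"
    then obtain a where "a \<in> ?C" "c = a - x" by blast
    then have "{x} \<subseteq> (\<lambda>a. a - c) ` ?C" by force
    then show "S ((\<lambda>a. a - c) ` ?C)"
      using fin by (intro equivariant_system_mono[OF S \<open>S {x}\<close>]) auto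
  qed (use fin in simp)
  then show ?case by (rule Suc.IH)
qed simp

text \<open>The right side defines an equivariant system containing \<open>S\<close> and holding of
  \<open>{x}\<close>. Conversely, any such system can undo the shifts.\<close>

lemma T_system_iff:
  assumes S: "equivariant_system S"
  shows "T_system x S A \<longleftrightarrow> (\<exists>p. S ((downshift x ^^ p) A))"
proof
  let ?Q = "\<lambda>A. \<exists>p. S ((downshift x ^^ p) A)"
  have "equivariant_system ?Q"
  proof (rule equivariant_systemI)
    fix A assume "?Q A"
    then obtain p where p: "S ((downshift x ^^ p) A)" ..
    show "finite A" using equivariant_systemD(1)[OF S p] by (simp add: finite_downshift_pow)
    show "A \<noteq> {}" using equivariant_systemD(2)[OF S p] by (auto simp: downshift_pow_empty)
  next
    fix A A' :: "'a set" assume "?Q A'" "A' \<subseteq> A" "finite A"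
    then show "?Q A"
      by (meson S downshift_pow_mono equivariant_system_mono finite_downshift_pow)
  next
    fix A u assume "?Q (A \<union> {u})" "?Q ((\<lambda>a. a - u) ` A)"
    then obtain p q where p: "S ((downshift x ^^ p) A \<union> (downshift x ^^ p) {u})"
      and q: "S ((\<lambda>a. a - u) ` (downshift x ^^ q) A)"
      by (auto simp only: downshift_pow_Un downshift_pow_translate)
    \<comment> \<open>Cutting all shifts of \<open>u\<close>, at most \<open>p\<close> of them, adds
      up to \<open>p\<close> shifts to the \<open>q\<close> already present.\<close>
    let ?C = "(downshift x ^^ (p + q)) A"
    have "finite A" using equivariant_systemD(1)[OF S p] by (simp add: finite_downshift_pow)
    then have fin: "finite ?C" by (simp add: finite_downshift_pow)
    have "S ?C"
    proof (rule equivariant_system_cuts[OF S])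
      show "finite ((downshift x ^^ p) {u})" by (simp add: finite_downshift_pow)
      show "S (?C \<union> (downshift x ^^ p) {u})"
        using fin downshift_pow_increasing[of p "p + q" x A]
        by (intro equivariant_system_mono[OF S p]) (auto simp: finite_downshift_pow)
      show "S ((\<lambda>a. a - c) ` ?C)" if "c \<in> (downshift x ^^ p) {u}" for c
        using fin translate_subset_downshift_pow[OF that]
        by (intro equivariant_system_mono[OF S q]) auto
    qed
    then show "?Q A" ..
  next
    fix a :: 'a assume "a \<le> 0"
    then have "S ((downshift x ^^ 0) {a})" by (simp add: equivariant_system_singleton[OF S])
    then show "?Q {a}" ..
  qed
  moreover have "S \<le> ?Q"
  proof (rule predicate1I)
    fix A assume "S A"
    then have "S ((downshift x ^^ 0) A)" by simp
    then show "?Q A" ..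
  qed
  moreover have "?Q {x}"
  proof
    \<comment> \<open>One shift puts \<open>x - x = 0\<close> into the set, and \<open>S {0}\<close>
      holds.\<close>
    show "S ((downshift x ^^ 1) {x})"
      by (rule equivariant_system_mono[OF S equivariant_system_singleton[OF S order_refl]])
        (auto simp: downshift_def)
  qed
  ultimately have "T_system x S \<le> ?Q" by (rule T_system_least(4)[OF S])
  then show "?Q A" if "T_system x S A" using that by (rule predicate1D)
  show "T_system x S A" if "?Q A"
    using that T_system_least(1-3)[OF S, of x]
    by (meson equivariant_downshift_pow predicate1D)
qed

section \<open>Intersections, monotonicity and commutation\<close>

text \<open>The two exponents from the explicit description can both be raised to their
  maximum.\<close>

lemma T_system_inf:
  assumes "equivariant_system S" "equivariant_system S'"
  shows "T_system x (inf S S') = inf (T_system x S) (T_system x S')"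
proof (rule antisym; rule predicate1I)
  fix A assume "T_system x (inf S S') A"
  then show "inf (T_system x S) (T_system x S') A"
    by (auto simp: T_system_iff assms equivariant_system_inf)
next
  fix A assume "inf (T_system x S) (T_system x S') A"
  then obtain p q where pq: "S ((downshift x ^^ p) A)" "S' ((downshift x ^^ q) A)"
    by (auto simp: T_system_iff assms)
  then have "finite A"
    using equivariant_systemD(1)[OF assms(1)] finite_downshift_pow by blast
  then have "S ((downshift x ^^ max p q) A)" "S' ((downshift x ^^ max p q) A)"
    using equivariant_system_mono[OF assms(1) pq(1)] equivariant_system_mono[OF assms(2) pq(2)]
    by (simp_all add: downshift_pow_increasing finite_downshift_pow)
  then show "T_system x (inf S S') A"
    by (auto simp: T_system_iff assms equivariant_system_inf)
qed

lemma T_system_mono: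
  assumes "equivariant_system S" "equivariant_system S'" "S \<le> S'"
  shows "T_system x S \<le> T_system x S'"
  using T_system_least(2,3)[OF assms(2), of x] assms(3)
  by (intro T_system_least(4)[OF assms(1)] T_system_least(1) assms(2)) (rule order_trans)

text \<open>The right side already contains \<open>T_system y S\<close> and holds of
  \<open>{x}\<close>, so leastness of the left side applies.\<close>

lemma T_system_commute_le:
  assumes S: "equivariant_system S"
  shows "T_system x (T_system y S) \<le> T_system y (T_system x S)"
proof -
  note T = T_system_least(1-3)
  have "T_system y (T_system x S) {x}"
    using T[OF T(1)[OF S]] T(3)[OF S] by (meson predicate1D)
  moreover have "T_system y S \<le> T_system y (T_system x S)"
    by (intro T_system_mono T S)
  ultimately show ?thesis
    by (intro T_system_least(4)[OF T(1)[OF S]] T(1) S)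
qed

lemma U_system_equivariant: "equivariant_system S \<Longrightarrow> equivariant_system (U_system x S)"
  unfolding U_system_def by (intro equivariant_system_inf T_system_least(1))

lemma U_system_increasing: "equivariant_system S \<Longrightarrow> S \<le> U_system x S"
  unfolding U_system_def by (intro le_infI T_system_least(2))

lemma U_system_mono:
  assumes "equivariant_system S" "equivariant_system S'" "S \<le> S'"
  shows "U_system x S \<le> U_system x S'"
  unfolding U_system_def by (intro inf_mono T_system_mono assms)

lemma U_T_system_le:
  assumes S: "equivariant_system S"
  shows "U_system y (T_system x S) \<le> T_system x (U_system y S)"
proof -
  have "U_system y (T_system x S) \<le> inf (T_system x (T_system y S)) (T_system x (T_system (- y) S))"
    unfolding U_system_def by (intro inf_mono T_system_commute_le S)
  also have "\<dots> = T_system x (U_system y S)"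
    unfolding U_system_def by (intro T_system_inf[symmetric] T_system_least(1) S)
  finally show ?thesis .
qed

section \<open>Iterated U\<close>

lemma foldr_U_equivariant:
  "equivariant_system S \<Longrightarrow> equivariant_system (foldr U_system xs S)"
  by (induction xs) (simp_all add: U_system_equivariant)

lemma foldr_U_increasing: "equivariant_system S \<Longrightarrow> S \<le> foldr U_system xs S"
proof (induction xs)
  case (Cons x xs)
  then show ?case
    using order_trans[OF Cons.IH U_system_increasing[OF foldr_U_equivariant, of S]] by simp
qed simp

lemma foldr_U_mono:
  assumes "equivariant_system S" "equivariant_system S'" "S \<le> S'"
  shows "foldr U_system xs S \<le> foldr U_system xs S'"
  by (induction xs) (simp_all add: U_system_mono foldr_U_equivariant assms)

text \<open>Lets a sign assumption on \<open>x\<close> be made inside the iterated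
  \<open>U_system\<close> and then moved outside, which the case analysis below requires.\<close>

lemma foldr_U_T_le:
  assumes S: "equivariant_system S"
  shows "foldr U_system xs (T_system x S) \<le> T_system x (foldr U_system xs S)"
proof (induction xs)
  case (Cons y xs)
  have "U_system y (foldr U_system xs (T_system x S)) \<le> U_system y (T_system x (foldr U_system xs S))"
    by (intro U_system_mono Cons.IH foldr_U_equivariant T_system_least(1) S)
  also have "\<dots> \<le> T_system x (U_system y (foldr U_system xs S))"
    by (intro U_T_system_le foldr_U_equivariant S)
  finally show ?case by simp
qed simp

text \<open>Each list element is a case distinction: adjoin \<open>x\<close> or \<open>- x\<close>
  to \<open>S\<close> and apply the induction hypothesis to the enlarged system. Both cases together
  give membership in the intersection \<open>U_system x\<close>.\<close>

lemma foldr_U_if_decided: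
  assumes "equivariant_system S"
    and "\<And>Q. equivariant_system Q \<Longrightarrow> S \<le> Q \<Longrightarrow> (\<And>x. x \<in> set xs \<Longrightarrow> Q {x} \<or> Q {- x}) \<Longrightarrow> Q D"
  shows "foldr U_system xs S D"
  using assms
proof (induction xs arbitrary: S)
  case Nil
  have "S D" by (rule Nil.prems(2)) (simp_all add: Nil.prems(1))
  then show ?case by simp
next
  case (Cons x xs)
  note S = \<open>equivariant_system S\<close>
  have "T_system y (foldr U_system xs S) D" if y: "y = x \<or> y = - x" for y
  proof -
    note T = T_system_least(1-3)[OF S, of y]
    have "foldr U_system xs (T_system y S) D"
    proof (rule Cons.IH[OF T(1)])
      fix Q assume Q: "equivariant_system Q" "T_system y S \<le> Q"
        and dec: "\<And>z. z \<in> set xs \<Longrightarrow> Q {z} \<or> Q {- z}"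
      have "Q {y}" using Q(2) T(3) by (rule predicate1D)
      then have "Q {z} \<or> Q {- z}" if "z \<in> set (x # xs)" for z
        using that y dec by auto
      then show "Q D"
        using Cons.prems(2)[OF Q(1) order_trans[OF T(2) Q(2)]] by blast
    qed
    then show ?thesis using foldr_U_T_le[OF S] by (rule rev_predicate1D)
  qed
  then have "U_system x (foldr U_system xs S) D" unfolding U_system_def by simp
  then show ?case by simp
qed

section \<open>Regularity of L\<close>

text \<open>The preorder induced by \<open>S\<close> is total on the finite set
  \<open>A\<close>.\<close>

lemma equivariant_system_minimum:
  assumes S: "equivariant_system S" and "finite A" "A \<noteq> {}"
    and "\<And>a b. a \<in> A \<Longrightarrow> b \<in> A \<Longrightarrow> S {a - b} \<or> S {b - a}"
  shows "\<exists>m\<in>A. \<forall>a\<in>A. S {m - a}"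
  using assms(2-)
proof (induction A rule: finite_ne_induct)
  case (singleton a)
  then show ?case by (simp add: equivariant_system_singleton[OF S])
next
  case (insert a A)
  then obtain m where m: "m \<in> A" "\<forall>b\<in>A. S {m - b}" by blast
  have a: "S {a - a}" by (simp add: equivariant_system_singleton[OF S])
  consider "S {m - a}" | "S {a - m}" using insert.prems m(1) by blast
  then show ?case
  proof cases
    case 1
    then show ?thesis using m by blast
  next
    case 2
    then have "\<forall>b\<in>A. S {a - b}" using equivariant_system_trans[OF S 2] m(2) by blast
    then show ?thesis using a by blast
  qed
qed

text \<open>Every \<open>d\<close> in \<open>D\<close> is cut from \<open>E \<union> D\<close>,
  since translating \<open>E\<close> by \<open>d\<close> yields a set containing
  \<open>e - d\<close>.\<close>

lemma equivariant_system_reduce: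
  assumes S: "equivariant_system S" and "S D" "finite E" "E \<noteq> {}"
    and "\<And>d. d \<in> D \<Longrightarrow> \<exists>e\<in>E. S {e - d}"
  shows "S E"
proof (rule equivariant_system_cuts[OF S])
  show "finite D" by (rule equivariant_systemD(1)[OF S \<open>S D\<close>])
  then show "S (E \<union> D)" using assms(3) by (intro equivariant_system_mono[OF S \<open>S D\<close>]) auto
  fix d assume "d \<in> D"
  then obtain e where "e \<in> E" and e: "S {e - d}" using assms(5) by blast
  then show "S ((\<lambda>a. a - d) ` E)"
    using assms(3) by (intro equivariant_system_mono[OF S e]) auto
qed

text \<open>If \<open>m\<close> and \<open>n\<close> are minima of \<open>A\<close> and
  \<open>B\<close>, then \<open>m + n\<close> is one of \<open>A + B\<close>, so the hypotheses
  shrink to \<open>{m + n, m}\<close> and \<open>{m + n, n}\<close>.\<close>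

lemma decided_system_regular:
  assumes S: "equivariant_system S" and A: "finite A" "A \<noteq> {}" and B: "finite B" "B \<noteq> {}"
    and hyps: "S ((A + B) \<union> A)" "S ((A + B) \<union> B)"
    and decA: "\<And>a a'. a \<in> A \<Longrightarrow> a' \<in> A \<Longrightarrow> S {a - a'} \<or> S {a' - a}"
    and decB: "\<And>b b'. b \<in> B \<Longrightarrow> b' \<in> B \<Longrightarrow> S {b - b'} \<or> S {b' - b}"
    and dec: "\<And>b. b \<in> B \<Longrightarrow> S {b} \<or> S {- b}"
  shows "S (A + B)"
proof -
  obtain m where m: "m \<in> A" "\<forall>a\<in>A. S {m - a}"
    using equivariant_system_minimum[OF S A decA] by blast
  obtain n where n: "n \<in> B" "\<forall>b\<in>B. S {n - b}"
    using equivariant_system_minimum[OF S B decB] by blast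
  have mn: "S {(m + n) - d}" if "d \<in> A + B" for d
  proof -
    obtain a b where "a \<in> A" "b \<in> B" and d: "d = a + b"
      using \<open>d \<in> A + B\<close> by (rule set_plus_elim)
    then have "S {(m + n) - (a + n)}" "S {(a + n) - (a + b)}" using m n by simp_all
    then show ?thesis unfolding d by (rule equivariant_system_trans[OF S])
  qed
  have 1: "S {m + n, m}"
    by (rule equivariant_system_reduce[OF S hyps(1)]) (use mn m in auto)
  have 2: "S {m + n, n}"
    by (rule equivariant_system_reduce[OF S hyps(2)]) (use mn n in auto)
  have 0: "S {0}" by (simp add: equivariant_system_singleton[OF S])
  have "S {m + n}"
  \<comment> \<open>If \<open>n\<close> counts as nonpositive, \<open>m + n\<close> lies below
    \<open>m\<close> and the first pair suffices. Otherwise \<open>m\<close> lies below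
    \<open>m + n\<close>, so the first pair gives \<open>S {m}\<close>; then \<open>m + n\<close>
    lies below \<open>n\<close> and the second pair suffices.\<close>
  proof (cases "S {n}")
    case True
    show ?thesis
      by (rule equivariant_system_reduce[OF S 1]) (use 0 True in auto)
  next
    case False
    then have "S {- n}" using dec n(1) by blast
    then have "S {m}"
      by (intro equivariant_system_reduce[OF S 1]) (use 0 in auto)
    then show ?thesis
      by (intro equivariant_system_reduce[OF S 2]) (use 0 in auto)
  qed
  then show ?thesis
    by (rule equivariant_system_mono[OF S])
      (use m n A B in \<open>auto intro: set_plus_intro finite_set_plus\<close>)
qed

lemma foldr_U_regular:
  assumes S: "equivariant_system S" and A: "finite A" "A \<noteq> {}" and B: "finite B" "B \<noteq> {}"
    and hyps: "S ((A + B) \<union> A)" "S ((A + B) \<union> B)"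
  shows "\<exists>xs. foldr U_system xs S (A + B)"
proof -
  \<comment> \<open>The differences make minima of \<open>A\<close> and \<open>B\<close> available;
    \<open>B\<close> itself serves the case distinction on the sign of its minimum.\<close>
  let ?X = "(\<lambda>(a, a'). a - a') ` (A \<times> A) \<union> (\<lambda>(b, b'). b - b') ` (B \<times> B) \<union> B"
  obtain xs where xs: "set xs = ?X"
    using finite_list[of ?X] A B by auto
  have "foldr U_system xs S (A + B)"
  proof (rule foldr_U_if_decided[OF S])
    fix Q assume Q: "equivariant_system Q" "S \<le> Q"
      and dec: "\<And>x. x \<in> set xs \<Longrightarrow> Q {x} \<or> Q {- x}"
    show "Q (A + B)"
    proof (rule decided_system_regular[OF Q(1) A B])
      show "Q ((A + B) \<union> A)" using Q(2) hyps(1) by (rule predicate1D)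
      show "Q ((A + B) \<union> B)" using Q(2) hyps(2) by (rule predicate1D)
      show "Q {a - a'} \<or> Q {a' - a}" if "a \<in> A" "a' \<in> A" for a a'
        using dec[of "a - a'"] that by (auto simp: xs)
      show "Q {b - b'} \<or> Q {b' - b}" if "b \<in> B" "b' \<in> B" for b b'
        using dec[of "b - b'"] that by (auto simp: xs)
      show "Q {b} \<or> Q {- b}" if "b \<in> B" for b
        using dec[of b] that by (auto simp: xs)
    qed
  qed
  then show ?thesis ..
qed

section \<open>\<open>L_system\<close> as a directed union\<close>

lemma L_system_iff: "L_system S A \<longleftrightarrow> (\<exists>xs. foldr U_system xs S A)"
  by (simp add: L_system_def)

lemma L_system_directed:
  assumes S: "equivariant_system S" and "L_system S A" "L_system S B"
  obtains xs where "foldr U_system xs S A" "foldr U_system xs S B"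
proof -
  obtain xs ys where xs: "foldr U_system xs S A" and ys: "foldr U_system ys S B"
    using assms(2,3) by (auto simp: L_system_iff)
  have "foldr U_system xs S \<le> foldr U_system (xs @ ys) S"
    by (simp add: foldr_U_mono foldr_U_equivariant foldr_U_increasing S)
  moreover have "foldr U_system ys S \<le> foldr U_system (xs @ ys) S"
    by (simp add: foldr_U_equivariant foldr_U_increasing S)
  ultimately show ?thesis using that xs ys by (meson predicate1D)
qed

lemma L_system_equivariant:
  assumes S: "equivariant_system S"
  shows "equivariant_system (L_system S)"
proof (rule equivariant_systemI)
  note E = foldr_U_equivariant[OF S]
  show "finite A" "A \<noteq> {}" if "L_system S A" for A
    using that equivariant_systemD[OF E] unfolding L_system_iff by blast+
  show "L_system S A" if "L_system S A'" "A' \<subseteq> A" "finite A" for A A'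
    using that equivariant_system_mono[OF E] unfolding L_system_iff by blast
  \<comment> \<open>The two hypotheses may come from different lists, so directedness is used to
    find a common one.\<close>
  show "L_system S A" if "L_system S (A \<union> {u})" "L_system S ((\<lambda>a. a - u) ` A)" for A u
    using L_system_directed[OF S that] equivariant_system_cut[OF E] L_system_iff by metis
  show "L_system S {a}" if "a \<le> 0" for a
    using equivariant_system_singleton[OF E that] unfolding L_system_iff by blast
qed

lemma L_system_regular:
  assumes S: "equivariant_system S"
  shows "regular_system (L_system S)"
  unfolding regular_system_def
proof (intro conjI allI impI)
  show "equivariant_system (L_system S)" by (rule L_system_equivariant[OF S])
next
  fix A B
  assume asm: "finite A \<and> A \<noteq> {} \<and> finite B \<and> B \<noteq> {} \<and>
    L_system S ((A + B) \<union> A) \<and> L_system S ((A + B) \<union> B)"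
  then obtain ys where "foldr U_system ys S ((A + B) \<union> A)" "foldr U_system ys S ((A + B) \<union> B)"
    using L_system_directed[OF S] by metis
  then obtain xs where "foldr U_system xs (foldr U_system ys S) (A + B)"
    using foldr_U_regular[OF foldr_U_equivariant[OF S]] asm by blast
  then have "foldr U_system (xs @ ys) S (A + B)" by simp
  then show "L_system S (A + B)" unfolding L_system_iff by blast
next
  fix x :: 'a
  have "foldr U_system [x] S {x, - x}"
  proof (rule foldr_U_if_decided[OF S])
    fix Q assume Q: "equivariant_system Q" and "\<And>y. y \<in> set [x] \<Longrightarrow> Q {y} \<or> Q {- y}"
    then consider "Q {x}" | "Q {- x}" by auto
    then show "Q {x, - x}" by cases (erule equivariant_system_mono[OF Q]; simp)+
  qed
  then show "L_system S {x, - x}" unfolding L_system_iff by blast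
qed

section \<open>Leastness\<close>

lemma regular_systemD:
  assumes "regular_system R"
  shows "equivariant_system R" "R {x, - x}"
    and "finite A \<Longrightarrow> A \<noteq> {} \<Longrightarrow> finite B \<Longrightarrow> B \<noteq> {} \<Longrightarrow> R ((A + B) \<union> A) \<Longrightarrow> R ((A + B) \<union> B)
      \<Longrightarrow> R (A + B)"
  using assms unfolding regular_system_def by blast+

text \<open>A stronger cut: the translate is assumed only jointly with \<open>D\<close>. It is the
  regularity condition for \<open>D - u\<close> and \<open>{u}\<close>, whose sum is
  \<open>D\<close>.\<close>

lemma regular_system_cut:
  assumes R: "regular_system R" and 1: "R (D \<union> {u})" and 2: "R (D \<union> (\<lambda>d. d - u) ` D)"
  shows "R D"
proof -
  have D: "finite D" "D \<noteq> {}"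
    using equivariant_systemD[OF regular_systemD(1)[OF R] 2] by auto
  let ?A = "(\<lambda>d. d - u) ` D"
  have AD: "?A + {u} = D" by (force simp: set_plus_def)
  have "R (?A + {u})"
    by (rule regular_systemD(3)[OF R]) (use D 1 2 AD in auto)
  then show ?thesis by (simp only: AD)
qed

lemma regular_system_cuts:
  assumes R: "regular_system R" and "finite C" "R (D \<union> C)"
    and "\<And>c. c \<in> C \<Longrightarrow> R (D \<union> (\<lambda>d. d - c) ` D)"
  shows "R D"
  using assms(2-)
proof (induction C)
  case (insert c C)
  note E = regular_systemD(1)[OF R]
  have "finite (D \<union> C)" using equivariant_systemD(1)[OF E insert.prems(1)] by auto
  then have "R ((D \<union> C) \<union> (\<lambda>d. d - c) ` (D \<union> C))"
    by (intro equivariant_system_mono[OF E insert.prems(2)[of c]]) auto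
  moreover have "R ((D \<union> C) \<union> {c})" using insert.prems(1) by simp
  ultimately have "R (D \<union> C)" by (metis regular_system_cut[OF R])
  then show ?case using insert.IH insert.prems(2) by blast
qed simp

text \<open>Each \<open>c + x\<close> can be cut away in the presence of \<open>c\<close> and \<open>x\<close>, because
  \<open>c - (c + x) = - x\<close> and \<open>R {x, - x}\<close>.\<close>

lemma regular_upshift_pow:
  assumes R: "regular_system R" and "R ((downshift (- x) ^^ q) A \<union> {x})"
  shows "R (A \<union> {x})"
  using assms(2)
proof (induction q)
  case (Suc q)
  note E = regular_systemD(1)[OF R]
  let ?C = "(downshift (- x) ^^ q) A"
  have RC: "R ((?C \<union> {x}) \<union> (\<lambda>a. a + x) ` ?C)"
    using Suc.prems by (simp add: downshift_pow_Suc Un_ac del: funpow.simps)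
  have fin: "finite ?C" using equivariant_systemD(1)[OF E RC] by simp
  have "R (?C \<union> {x})"
  proof (rule regular_system_cuts[OF R _ RC])
    fix c assume "c \<in> (\<lambda>a. a + x) ` ?C"
    then obtain a where "a \<in> ?C" "c = a + x" by blast
    then have "- x \<in> (\<lambda>d. d - c) ` (?C \<union> {x})" by force
    then show "R ((?C \<union> {x}) \<union> (\<lambda>d. d - c) ` (?C \<union> {x}))"
      using fin by (intro equivariant_system_mono[OF E regular_systemD(2)[OF R, of x]]) auto
  qed (use fin in simp)
  then show ?case by (rule Suc.IH)
qed simp

text \<open>The half for \<open>- x\<close> yields \<open>R (A \<union> {x})\<close>. With
  \<open>x\<close> present, the strengthened cut at \<open>x\<close> removes the shifts in the half
  for \<open>x\<close> one by one.\<close>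

lemma U_system_regular_le:
  assumes R: "regular_system R"
  shows "U_system x R \<le> R"
proof (rule predicate1I)
  fix A assume "U_system x R A"
  note E = regular_systemD(1)[OF R]
  obtain p q where p: "R ((downshift x ^^ p) A)" and q: "R ((downshift (- x) ^^ q) A)"
    using \<open>U_system x R A\<close> by (auto simp: U_system_def T_system_iff E)
  have "R ((downshift (- x) ^^ q) A \<union> {x})"
    using equivariant_systemD(1)[OF E q] by (intro equivariant_system_mono[OF E q]) auto
  then have x: "R (A \<union> {x})" by (rule regular_upshift_pow[OF R])
  from p show "R A"
  proof (induction p)
    case (Suc p)
    let ?C = "(downshift x ^^ p) A"
    have C: "R (?C \<union> (\<lambda>a. a - x) ` ?C)" using Suc.prems by (simp only: downshift_pow_Suc)
    have "R (?C \<union> {x})"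
      using equivariant_systemD(1)[OF E C] downshift_pow_increasing[of 0 p x A]
      by (intro equivariant_system_mono[OF E x]) auto
    then have "R ?C" using C by (rule regular_system_cut[OF R])
    then show ?case by (rule Suc.IH)
  qed simp
qed

lemma foldr_U_regular_le:
  assumes R: "regular_system R"
  shows "foldr U_system xs R \<le> R"
proof (induction xs)
  case (Cons x xs)
  note E = regular_systemD(1)[OF R]
  have "U_system x (foldr U_system xs R) \<le> U_system x R"
    by (intro U_system_mono foldr_U_equivariant E Cons.IH)
  also have "\<dots> \<le> R" by (rule U_system_regular_le[OF R])
  finally show ?case by simp
qed simp

theorem theorem4p5:
  fixes S :: "'a::preordered_ab_group_add set \<Rightarrow> bool"
  assumes "equivariant_system S"
  shows "regular_system (L_system S) \<and> S \<le> L_system S \<and>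
         (\<forall>R. regular_system R \<and> S \<le> R \<longrightarrow> L_system S \<le> R)"
proof (intro conjI allI impI)
  show "regular_system (L_system S)" by (rule L_system_regular[OF assms])
  have "foldr U_system [] S \<le> L_system S" unfolding L_system_def by (rule SUP_upper) simp
  then show "S \<le> L_system S" by simp
next
  fix R assume "regular_system R \<and> S \<le> R"
  then have R: "regular_system R" "S \<le> R" by simp_all
  show "L_system S \<le> R"
    unfolding L_system_def
  proof (rule SUP_least)
    fix xs
    \<comment> \<open>By monotonicity \<open>S\<close> is replaced by \<open>R\<close>, which the
      iterated \<open>U_system\<close> does not enlarge.\<close>
    have "foldr U_system xs S \<le> foldr U_system xs R"
      by (intro foldr_U_mono assms regular_systemD(1) R)
    also have "\<dots> \<le> R" by (rule foldr_U_regular_le[OF R(1)])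
    finally show "foldr U_system xs S \<le> R" .
  qed
qed

end
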